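(* Let $K\ge 1$ be a finite integer and let $q_0,\dots,q_K$ be positive real constants. Suppose that $$q_k\le 1\quad\text{for all }k\in\{0,\dots,K\}.$$ Then the ordinary differential equation $$\frac{\mathrm d\phi_k}{\mathrm dt}(t)=q_{k-1}\,\phi_{k-1}(t)\,\gamma(t)-q_k\,\phi_k(t),\qquad k\in\{1,\dots,K\},$$ where $$\phi_0(t)=1-\sum_{k=1}^K\phi_k(t),\qquad \bar q(t)=\sum_{k=0}^K q_k\phi_k(t),\qquad \gamma(t)=1-e^{-\bar q(t)},$$ considered on the set of probability vectors $(\phi_0,\dots,\phi_K)$ on $\{0,\dots,K\}$, is globally stable.
   Context: The state $\boldsymbol\phi(t)=(\phi_0(t),\dots,\phi_K(t))$ is a probability vector: $\phi_k(t)\ge 0$ and $\sum_{k=0}^K\phi_k(t)=1$. Here $\phi_k(t)$ is the limiting fraction of nodes in backoff stage $k$, $q_k$ is the scaled attempt rate in stage $k$, and $\gamma(t)$ is the limiting collision probability. The ODE is called globally stable if it has a unique equilibrium (stationary) point in the set of probability vectors and, for every initial probability vector $\boldsymbol\phi(0)$, the solution $\boldsymbol\phi(t)$ converges to this equilibrium point as $t\to\infty$. *)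

theory Defs
  imports Complex_Main
begin

(* States are functions on nat, normalised to vanish beyond K so that equality
   of states is equality of the vectors (x_0, ..., x_K). *)
definition prob_vectors :: "nat \<Rightarrow> (nat \<Rightarrow> real) set" where
  "prob_vectors K = {x. (\<forall>k\<le>K. 0 \<le> x k) \<and> (\<Sum>k=0..K. x k) = 1 \<and> (\<forall>k>K. x k = 0)}"

definition mean_rate :: "nat \<Rightarrow> (nat \<Rightarrow> real) \<Rightarrow> (nat \<Rightarrow> real) \<Rightarrow> real" where
  "mean_rate K q x = (\<Sum>k=0..K. q k * x k)"

definition collision_prob :: "nat \<Rightarrow> (nat \<Rightarrow> real) \<Rightarrow> (nat \<Rightarrow> real) \<Rightarrow> real" where
  "collision_prob K q x = 1 - exp (- mean_rate K q x)"

(* Used only for k in {1..K}; component 0 is determined by the normalisation. *)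
definition drift :: "nat \<Rightarrow> (nat \<Rightarrow> real) \<Rightarrow> (nat \<Rightarrow> real) \<Rightarrow> nat \<Rightarrow> real" where
  "drift K q x k = q (k - 1) * x (k - 1) * collision_prob K q x - q k * x k"

(* Membership in prob_vectors K contains the relation
   phi_0(t) = 1 - (phi_1(t) + ... + phi_K(t)). *)
definition is_solution :: "nat \<Rightarrow> (nat \<Rightarrow> real) \<Rightarrow> (real \<Rightarrow> nat \<Rightarrow> real) \<Rightarrow> bool" where
  "is_solution K q \<phi> \<longleftrightarrow>
     (\<forall>t\<ge>0. \<phi> t \<in> prob_vectors K \<and>
        (\<forall>k\<in>{1..K}. ((\<lambda>s. \<phi> s k) has_real_derivative drift K q (\<phi> t) k) (at t within {0..})))"

definition is_equilibrium :: "nat \<Rightarrow> (nat \<Rightarrow> real) \<Rightarrow> (nat \<Rightarrow> real) \<Rightarrow> bool" where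
  "is_equilibrium K q x \<longleftrightarrow> x \<in> prob_vectors K \<and> (\<forall>k\<in>{1..K}. drift K q x k = 0)"

(* The existence clause makes explicit that every initial probability vector has
   a solution defined for all t >= 0 that remains a probability vector. *)
definition globally_stable :: "nat \<Rightarrow> (nat \<Rightarrow> real) \<Rightarrow> bool" where
  "globally_stable K q \<longleftrightarrow>
     (\<exists>x. is_equilibrium K q x \<and>
        (\<forall>y. is_equilibrium K q y \<longrightarrow> y = x) \<and>
        (\<forall>x0\<in>prob_vectors K.
           (\<exists>\<phi>. is_solution K q \<phi> \<and> \<phi> 0 = x0) \<and>
           (\<forall>\<phi>. is_solution K q \<phi> \<and> \<phi> 0 = x0 \<longrightarrow>
              (\<forall>k\<le>K. ((\<lambda>t. \<phi> t k) \<longlongrightarrow> x k) at_top))))"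

end

theory Submission
  imports Defs "HOL-Analysis.Analysis"
begin

text \<open>Completed by the equation of stage 0, the drift is cooperative on probability vectors and
  conserves mass.  Indeed all rates are at most 1, so the mean rate \<open>s\<close> is at most 1, where the
  success flow \<open>s exp (- s)\<close> into stage 0 is increasing in \<open>s\<close>.  Hence \<open>T = id + drift\<close> maps
  probability vectors to probability vectors, and it is even a strict contraction in the
  \<open>l1\<close>-norm, with factor \<open>c = 1 - (min q) / e\<close>.  Its fixed point is the unique equilibrium.  Written
  as \<open>x' = T x - x\<close>, the equation has solutions by Banach's theorem for the variation of constants
  operator, and Gronwall's inequality gives convergence at the rate \<open>exp (- (1 - c) t)\<close>.\<close>

section \<open>The l1-distance between states\<close>

definition l1_dist :: "nat \<Rightarrow> (nat \<Rightarrow> real) \<Rightarrow> (nat \<Rightarrow> real) \<Rightarrow> real" where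
  "l1_dist K x y = (\<Sum>k=0..K. \<bar>x k - y k\<bar>)"

lemma l1_dist_nonneg: "0 \<le> l1_dist K x y"
  unfolding l1_dist_def by (simp add: sum_nonneg)

lemma l1_dist_commute: "l1_dist K x y = l1_dist K y x"
  unfolding l1_dist_def by (simp add: abs_minus_commute)

lemma l1_dist_component: "k \<le> K \<Longrightarrow> \<bar>x k - y k\<bar> \<le> l1_dist K x y"
  unfolding l1_dist_def by (rule member_le_sum) auto

text \<open>Gives the bound \<open>D = 2\<close> that starts the fixed point iteration, for single
  states and for curves alike.\<close>

lemma l1_dist_prob_vectors_le:
  assumes "x \<in> prob_vectors K" "y \<in> prob_vectors K"
  shows "l1_dist K x y \<le> 2"
proof -
  have "l1_dist K x y \<le> (\<Sum>k=0..K. x k + y k)"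
    unfolding l1_dist_def using assms by (intro sum_mono) (auto simp: prob_vectors_def abs_le_iff)
  then show ?thesis using assms by (simp add: prob_vectors_def sum.distrib)
qed

section \<open>Fixed points of l1-contractions\<close>

text \<open>The increments are dominated by a geometric series, so the limit exists; the error bound
  is the tail of that series from \<open>n\<close> on.\<close>

lemma geometric_increments_limit:
  fixes a :: "nat \<Rightarrow> real"
  assumes "0 \<le> c" "c < 1" and step: "\<And>n. \<bar>a (Suc n) - a n\<bar> \<le> B * c ^ n"
  obtains l where "a \<longlonglongrightarrow> l" "\<And>n. \<bar>a n - l\<bar> \<le> B / (1 - c) * c ^ n"
proof -
  have geo: "summable (\<lambda>n. B * c ^ n)"
    using assms by (intro summable_mult summable_geometric) auto
  have S: "summable (\<lambda>n. a (Suc n) - a n)"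
    by (rule summable_comparison_test'[OF geo, of 0]) (use step in auto)
  define l where "l = a 0 + (\<Sum>n. a (Suc n) - a n)"
  have "(\<lambda>n. \<Sum>i<n. a (Suc i) - a i) \<longlonglongrightarrow> (\<Sum>n. a (Suc n) - a n)"
    by (rule summable_LIMSEQ[OF S])
  then have "(\<lambda>n. a n - a 0) \<longlonglongrightarrow> (\<Sum>n. a (Suc n) - a n)"
    by (simp add: sum_lessThan_telescope)
  then have "(\<lambda>n. a 0 + (a n - a 0)) \<longlonglongrightarrow> l"
    unfolding l_def by (intro tendsto_intros)
  then have lim: "a \<longlonglongrightarrow> l" by simp
  \<comment> \<open>The partial tail is kept as a difference of two values of
    \<open>B / (1 - c) * c ^ n\<close>, so that the induction on \<open>m\<close>
    telescopes.\<close>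
  have dist: "\<bar>a (n + m) - a n\<bar> \<le> B / (1 - c) * c ^ n - B / (1 - c) * c ^ (n + m)" for n m
  proof (induction m)
    case (Suc m)
    have "D * p - D * (c * p) = D * (1 - c) * p" for D p :: real
      by (simp add: algebra_simps)
    from this[of "B / (1 - c)" "c ^ (n + m)"]
    have "B * c ^ (n + m) = B / (1 - c) * c ^ (n + m) - B / (1 - c) * c ^ (n + Suc m)"
      using \<open>c < 1\<close> by simp
    then show ?case using step[of "n + m"] Suc by simp
  qed simp
  have "0 \<le> B" using step[of 0] by simp
  have "\<bar>a n - l\<bar> \<le> B / (1 - c) * c ^ n" for n
  proof -
    have "(\<lambda>m. \<bar>a (m + n) - a n\<bar>) \<longlonglongrightarrow> \<bar>l - a n\<bar>"
      by (intro tendsto_intros LIMSEQ_ignore_initial_segment lim)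
    moreover have "\<bar>a (m + n) - a n\<bar> \<le> B / (1 - c) * c ^ n" for m
    proof -
      have "0 \<le> B / (1 - c) * c ^ (n + m)" using \<open>0 \<le> B\<close> assms by simp
      then show ?thesis using dist[of n m] by (simp add: add.commute)
    qed
    ultimately have "\<bar>l - a n\<bar> \<le> B / (1 - c) * c ^ n"
      by (intro Lim_bounded[of _ _ 0]) auto
    then show ?thesis by (simp add: abs_minus_commute)
  qed
  with lim that show ?thesis by blast
qed

text \<open>With \<open>I\<close> a singleton this gives the equilibrium, with \<open>I\<close> the time axis the solutions.\<close>

lemma contraction_fixed_point:
  fixes M :: "('i \<Rightarrow> nat \<Rightarrow> real) set"
  assumes c: "0 \<le> c" "c < 1"
    and start: "x0 \<in> M"
    and into: "\<And>x. x \<in> M \<Longrightarrow> A x \<in> M"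
    and bounded: "\<And>x y i. x \<in> M \<Longrightarrow> y \<in> M \<Longrightarrow> i \<in> I \<Longrightarrow> l1_dist K (x i) (y i) \<le> D"
    and contract: "\<And>x y C i. x \<in> M \<Longrightarrow> y \<in> M \<Longrightarrow> (\<And>i. i \<in> I \<Longrightarrow> l1_dist K (x i) (y i) \<le> C)
        \<Longrightarrow> i \<in> I \<Longrightarrow> l1_dist K (A x i) (A y i) \<le> c * C"
    and support: "\<And>x i k. x \<in> M \<Longrightarrow> i \<in> I \<Longrightarrow> k > K \<Longrightarrow> x i k = 0"
    and closed: "\<And>X x. (\<And>n. X n \<in> M) \<Longrightarrow>
        (\<And>k. uniform_limit I (\<lambda>n i. X n i k) (\<lambda>i. x i k) sequentially) \<Longrightarrow> x \<in> M"
  obtains x where "x \<in> M" "\<And>i. i \<in> I \<Longrightarrow> A x i = x i"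
proof -
  define X where "X n = (A ^^ n) x0" for n
  have X: "X n \<in> M" for n
    by (induction n) (simp_all add: X_def start into)
  have XSuc: "X (Suc n) = A (X n)" for n by (simp add: X_def)
  have inc: "i \<in> I \<Longrightarrow> l1_dist K (X (Suc n) i) (X n i) \<le> D * c ^ n" for n i
  proof (induction n arbitrary: i)
    case 0
    then show ?case using bounded[OF X X] by simp
  next
    case (Suc n)
    have "l1_dist K (A (X (Suc n)) i) (A (X n) i) \<le> c * (D * c ^ n)"
      by (rule contract[OF X X Suc.IH Suc.prems])
    then show ?case by (simp add: XSuc mult_ac)
  qed
  \<comment> \<open>Beyond \<open>K\<close> the increments are not controlled by
    \<open>l1_dist\<close>; the value 0 there agrees with \<open>support\<close>. For
    \<open>i\<close> outside \<open>I\<close> the sequence may diverge, and nothing is claimed about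
    \<open>lim\<close>.\<close>
  define x where "x i k = (if k \<le> K then lim (\<lambda>n. X n i k) else 0)" for i k
  define E where "E = D / (1 - c)"
  have close: "\<bar>X n i k - x i k\<bar> \<le> E * c ^ n" if "i \<in> I" "k \<le> K" for n i k
  proof -
    have "\<bar>X (Suc n) i k - X n i k\<bar> \<le> D * c ^ n" for n
      by (rule order_trans[OF l1_dist_component[OF that(2)] inc[OF that(1)]])
    then obtain l where l: "(\<lambda>n. X n i k) \<longlonglongrightarrow> l" "\<And>n. \<bar>X n i k - l\<bar> \<le> D / (1 - c) * c ^ n"
      using geometric_increments_limit[OF c, of "\<lambda>n. X n i k" D] by blast
    have "x i k = l" using that l(1) by (simp add: x_def limI)
    then show ?thesis using l(2) by (simp add: E_def)
  qed
  have geo: "(\<lambda>n. E' * c ^ n) \<longlonglongrightarrow> 0" for E'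
    using tendsto_mult_right_zero[OF LIMSEQ_power_zero[of c]] c by simp
  have "uniform_limit I (\<lambda>n i. X n i k) (\<lambda>i. x i k) sequentially" for k
  proof (cases "k \<le> K")
    case True
    show ?thesis
    proof (rule uniform_limitI)
      fix e :: real assume "e > 0"
      then have "\<forall>\<^sub>F n in sequentially. E * c ^ n < e"
        using geo by (rule order_tendstoD(2)[rotated])
      then show "\<forall>\<^sub>F n in sequentially. \<forall>i\<in>I. dist (X n i k) (x i k) < e"
        by eventually_elim (auto simp: dist_real_def intro: le_less_trans[OF close[OF _ True]])
    qed
  next
    case False
    then show ?thesis using support[OF X] by (intro uniform_limitI) (simp add: x_def)
  qed
  then have xM: "x \<in> M" by (rule closed[OF X])
  have l1_close: "l1_dist K (X n i) (x i) \<le> real (Suc K) * E * c ^ n" if "i \<in> I" for n i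
  proof -
    have "l1_dist K (X n i) (x i) \<le> (\<Sum>k=0..K. E * c ^ n)"
      unfolding l1_dist_def using close[OF that] by (intro sum_mono) auto
    then show ?thesis by simp
  qed
  have "A x i k = x i k" if "i \<in> I" for i k
  proof (cases "k \<le> K")
    case True
    \<comment> \<open>Both \<open>A x\<close> and \<open>x\<close> are compared with
      \<open>X (Suc n)\<close>: the first through \<open>contract\<close> applied to
      \<open>X n\<close> and \<open>x\<close>, the second through \<open>close\<close>. Letting
      \<open>n\<close> grow then forces equality.\<close>
    have "\<bar>A x i k - x i k\<bar> \<le> (c * (real (Suc K) * E) + c * E) * c ^ n" for n
    proof -
      have "l1_dist K (A (X n) i) (A x i) \<le> c * (real (Suc K) * E * c ^ n)"
        by (rule contract[OF X xM l1_close that])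
      then have "\<bar>X (Suc n) i k - A x i k\<bar> \<le> c * (real (Suc K) * E * c ^ n)"
        unfolding XSuc by (rule order_trans[OF l1_dist_component[OF True]])
      moreover have "\<bar>X (Suc n) i k - x i k\<bar> \<le> c * E * c ^ n"
        using close[OF that True, of "Suc n"] by (simp add: mult_ac)
      ultimately show ?thesis by (simp add: algebra_simps)
    qed
    then have "\<bar>A x i k - x i k\<bar> \<le> 0"
      by (intro LIMSEQ_le_const[OF geo]) auto
    then show ?thesis by simp
  next
    case False
    then show ?thesis using that support[OF xM] support[OF into[OF xM]] by simp
  qed
  then have "A x i = x i" if "i \<in> I" for i
    using that by (intro ext)
  then show ?thesis by (rule that[OF xM])
qed

section \<open>Integrals over the half-line and Gronwall's inequality\<close>

lemma integral_halfline_has_derivative: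
  fixes f :: "real \<Rightarrow> real"
  assumes "continuous_on {0..} f" "t \<ge> 0"
  shows "((\<lambda>t. integral {0..t} f) has_real_derivative f t) (at t within {0..})"
proof -
  \<comment> \<open>The upper end \<open>t + 1\<close> keeps \<open>t\<close> away from the right
    end, so that near \<open>t\<close> this interval coincides with the half-line, also for
    \<open>t = 0\<close>.\<close>
  have "((\<lambda>t. integral {0..t} f) has_real_derivative f t) (at t within {0..t + 1})"
    by (rule integral_has_real_derivative) (use assms in \<open>auto elim: continuous_on_subset\<close>)
  moreover have "at t within {0..t + 1} = at t within {0..}"
    by (rule at_within_nhd[of _ "{..<t + 1}"]) auto
  ultimately show ?thesis by simp
qed

lemma integral_exp_interval:
  fixes t :: real
  assumes "t \<ge> 0"
  shows "integral {0..t} exp = exp t - 1"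
proof -
  have "(exp has_integral exp t - exp 0) {0..t}"
    by (rule fundamental_theorem_of_calculus[OF assms])
      (auto intro!: derivative_eq_intros simp: has_real_derivative_iff_has_vector_derivative[symmetric])
  then show ?thesis by (simp add: integral_unique)
qed

text \<open>With \<open>W\<close> the right-hand side of the hypothesis,
  \<open>W' = c exp t v \<le> c W\<close>, so \<open>exp (- c t) W t\<close> never exceeds its
  initial value \<open>v0\<close>. Removing the weight \<open>exp t\<close> turns the growth rate
  \<open>c\<close> of \<open>W\<close> into the exponent \<open>- (1 - c)\<close>.\<close>

lemma gronwall_exp:
  fixes v :: "real \<Rightarrow> real"
  assumes cont: "continuous_on {0..} v"
    and le: "\<And>t. t \<ge> 0 \<Longrightarrow> exp t * v t \<le> v0 + c * integral {0..t} (\<lambda>s. exp s * v s)"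
    and t: "t \<ge> 0" and c: "0 \<le> c"
  shows "v t \<le> v0 * exp (- (1 - c) * t)"
proof -
  define W where "W t = v0 + c * integral {0..t} (\<lambda>s. exp s * v s)" for t
  have "continuous_on {0..} (\<lambda>s. exp s * v s)" by (intro continuous_intros cont)
  note [derivative_intros] = integral_halfline_has_derivative[OF this]
  have der: "((\<lambda>s. exp (- c * s) * W s) has_real_derivative
      c * exp (- c * s) * (exp s * v s - W s)) (at s within {0..})" if "s \<ge> 0" for s
    unfolding W_def using that
    by (auto intro!: derivative_eq_intros simp: algebra_simps)
  have "exp (- c * t) * W t \<le> exp (- c * 0) * W 0"
  proof (rule DERIV_nonpos_imp_decreasing_open[OF t])
    fix s assume s: "0 < s" "s < t"
    have "at s within {0..} = at s"
      by (rule at_within_interior) (use s in \<open>auto simp: interior_Ici[of "-1"]\<close>)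
    moreover have "c * exp (- c * s) * (exp s * v s - W s) \<le> 0"
      using le[of s] s c by (simp add: W_def mult_le_0_iff)
    ultimately show "\<exists>y. ((\<lambda>s. exp (- c * s) * W s) has_real_derivative y) (at s) \<and> y \<le> 0"
      using der[of s] s by auto
  next
    have "continuous_on {0..} (\<lambda>s. exp (- c * s) * W s)"
      by (rule DERIV_continuous_on) (use der in auto)
    then show "continuous_on {0..t} (\<lambda>s. exp (- c * s) * W s)"
      by (rule continuous_on_subset) auto
  qed
  moreover have "exp (- c * t) * (exp t * v t) \<le> exp (- c * t) * W t"
    using le[OF t] by (intro mult_left_mono) (simp_all add: W_def)
  moreover have "exp (- c * 0) * W 0 = v0" by (simp add: W_def)
  ultimately have "exp (- c * t) * (exp t * v t) \<le> v0" by linarith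
  then have "exp (- (1 - c) * t) * (exp (- c * t) * (exp t * v t)) \<le> exp (- (1 - c) * t) * v0"
    by (rule mult_left_mono) simp
  moreover have "exp (- (1 - c) * t) * exp (- c * t) * exp t = 1"
    unfolding exp_add[symmetric] by (simp add: algebra_simps)
  ultimately show ?thesis
    unfolding mult.assoc[symmetric] by (simp only: mult_1 mult.commute)
qed

section \<open>Auxiliary facts on flows and probability vectors\<close>

text \<open>Collision flow passes from each stage to the next and, in the completed system, from
  \<open>K\<close> back to 0. The identity serves the mass balance and the summation of the flow
  bounds in the l1 estimate.\<close>

lemma sum_cyclic_shift:
  fixes a :: "nat \<Rightarrow> real" and K :: nat
  shows "(\<Sum>k=0..K. if k = 0 then a K else a (k - 1)) = (\<Sum>k=0..K. a k)"
proof -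
  have "(\<Sum>k=0..K. if k = 0 then a K else a (k - 1)) = a K + (\<Sum>k=Suc 0..K. a (k - 1))"
    by (subst sum.atLeast_Suc_atMost) (auto intro: sum.cong)
  also have "(\<Sum>k=Suc 0..K. a (k - 1)) = (\<Sum>k<K. a k)"
    by (rule sum.reindex_bij_witness[of _ Suc "\<lambda>k. k - 1"]) auto
  also have "a K + (\<Sum>k<K. a k) = (\<Sum>k=0..K. a k)"
    by (simp add: atLeast0AtMost lessThan_Suc_atMost[symmetric])
  finally show ?thesis .
qed

text \<open>For \<open>s \<ge> 0\<close> the inequality
  \<open>1 - (s - r) \<le> exp (- (s - r))\<close> reduces the claim to
  \<open>0 \<le> (s - r) (1 - s)\<close>. For \<open>s < 0\<close> one factor is changed at a time,
  the sign of \<open>s\<close> reversing the order of the exponentials.\<close>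

lemma mult_exp_neg_mono:
  fixes r s :: real
  assumes "r \<le> s" "s \<le> 1"
  shows "r * exp (- r) \<le> s * exp (- s)"
proof (cases "0 \<le> s")
  case True
  have "0 \<le> (s - r) * (1 - s)" using assms by simp
  then have "r \<le> s * (1 - (s - r))" by (simp add: algebra_simps)
  also have "\<dots> \<le> s * exp (- (s - r))"
    using exp_ge_add_one_self[of "- (s - r)"] True by (intro mult_left_mono) linarith+
  finally have "r * exp (- r) \<le> s * exp (- (s - r)) * exp (- r)" by simp
  then show ?thesis by (simp add: mult.assoc exp_add[symmetric])
next
  case False
  have "r * exp (- r) \<le> s * exp (- r)" using assms by (intro mult_right_mono) auto
  also have "\<dots> \<le> s * exp (- s)" using assms False by (intro mult_left_mono_neg) auto
  finally show ?thesis .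
qed

lemma prob_vectors_closed:
  assumes "\<And>n. X n \<in> prob_vectors K" "\<And>k. (\<lambda>n. X n k) \<longlonglongrightarrow> x k"
  shows "x \<in> prob_vectors K"
proof -
  have "0 \<le> x k" if "k \<le> K" for k
    by (rule LIMSEQ_le_const[OF assms(2)]) (use assms(1) that in \<open>auto simp: prob_vectors_def\<close>)
  moreover have "x k = 0" if "k > K" for k
    using assms that LIMSEQ_unique[OF assms(2)[of k], of 0] by (simp add: prob_vectors_def)
  moreover have "(\<Sum>k=0..K. x k) = 1"
  proof -
    have "(\<lambda>n. \<Sum>k=0..K. X n k) \<longlonglongrightarrow> (\<Sum>k=0..K. x k)"
      by (intro tendsto_sum assms(2))
    then have "(\<lambda>n::nat. 1) \<longlonglongrightarrow> (\<Sum>k=0..K. x k)"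
      using assms(1) by (simp add: prob_vectors_def)
    then show ?thesis by (rule LIMSEQ_unique[OF tendsto_const, symmetric])
  qed
  ultimately show ?thesis by (simp add: prob_vectors_def)
qed

lemma prob_vectors_nonempty: "(\<lambda>k. if k = 0 then 1 else 0) \<in> prob_vectors K"
  by (simp add: prob_vectors_def)

section \<open>The completed drift as a map of probability vectors\<close>

locale slow_backoff =
  fixes K :: nat and q :: "nat \<Rightarrow> real"
  assumes q_pos: "k \<le> K \<Longrightarrow> q k > 0"
    and q_le_1: "k \<le> K \<Longrightarrow> q k \<le> 1"
begin

text \<open>One Euler step of length 1 of the drift completed to all components: mass leaving stage
  \<open>K\<close> after a collision, and all mass leaving after a success, returns to stage 0.\<close>

definition euler_step :: "(nat \<Rightarrow> real) \<Rightarrow> nat \<Rightarrow> real" where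
  "euler_step x k = (if k > K then 0 else
     (1 - q k) * x k
     + collision_prob K q x * (if k = 0 then q K * x K else q (k - 1) * x (k - 1))
     + (if k = 0 then mean_rate K q x * exp (- mean_rate K q x) else 0))"

lemma euler_step_pos: "k \<in> {1..K} \<Longrightarrow> euler_step x k = x k + drift K q x k"
  by (simp add: euler_step_def drift_def algebra_simps)

lemma mean_rate_bounds:
  assumes "x \<in> prob_vectors K"
  shows "0 \<le> mean_rate K q x" "mean_rate K q x \<le> 1"
proof -
  show "0 \<le> mean_rate K q x"
    unfolding mean_rate_def using assms q_pos
    by (intro sum_nonneg) (simp add: prob_vectors_def less_imp_le)
  have "mean_rate K q x \<le> (\<Sum>k=0..K. x k)"
    unfolding mean_rate_def using assms q_le_1
    by (intro sum_mono) (simp add: prob_vectors_def mult_left_le_one_le q_pos less_imp_le)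
  then show "mean_rate K q x \<le> 1" using assms by (simp add: prob_vectors_def)
qed

text \<open>The total outflow \<open>s = mean_rate K q x\<close> returns completely: the share
  \<open>1 - exp (- s)\<close> through the cyclic shift, the share \<open>exp (- s)\<close> at stage
  0.\<close>

lemma sum_euler_step: "(\<Sum>k=0..K. euler_step x k) = (\<Sum>k=0..K. x k)"
proof -
  let ?s = "mean_rate K q x"
  have "(\<Sum>k=0..K. euler_step x k) = (\<Sum>k=0..K. x k - q k * x k
      + collision_prob K q x * (if k = 0 then q K * x K else q (k - 1) * x (k - 1))
      + (if k = 0 then ?s * exp (- ?s) else 0))"
    by (rule sum.cong) (simp_all add: euler_step_def algebra_simps)
  also have "\<dots> = (\<Sum>k=0..K. x k) - ?s + collision_prob K q x * ?s + ?s * exp (- ?s)"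
    unfolding sum.distrib sum_subtractf sum_distrib_left[symmetric]
      sum_cyclic_shift[of "\<lambda>k. q k * x k"]
    by (simp add: mean_rate_def)
  finally show ?thesis by (simp add: collision_prob_def algebra_simps)
qed

text \<open>The bound on the rates makes the retained fraction \<open>1 - q k\<close> nonnegative;
  all other terms are products of nonnegative factors.\<close>

lemma euler_step_in_prob_vectors:
  assumes "x \<in> prob_vectors K"
  shows "euler_step x \<in> prob_vectors K"
proof -
  have "0 \<le> euler_step x k" if "k \<le> K" for k
  proof -
    have "0 \<le> collision_prob K q x"
      using mean_rate_bounds[OF assms] by (simp add: collision_prob_def)
    moreover have "0 \<le> q j * x j" if "j \<le> K" for j
      using assms that q_pos[OF that] by (simp add: prob_vectors_def)
    ultimately show ?thesis
      using that assms mean_rate_bounds[OF assms] q_le_1[OF that]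
      by (auto simp: euler_step_def prob_vectors_def intro!: add_nonneg_nonneg mult_nonneg_nonneg)
  qed
  then show ?thesis
    using assms sum_euler_step[of x] by (simp add: prob_vectors_def euler_step_def)
qed

section \<open>Contraction of the Euler step\<close>

text \<open>The number \<open>exp (- 1)\<close> bounds the success probability
  \<open>exp (- s)\<close> from below, since the mean rate satisfies \<open>s \<le> 1\<close> on
  probability vectors.\<close>

definition contraction_factor :: real where
  "contraction_factor = 1 - Min (q ` {0..K}) * exp (- 1)"

lemma Min_rate:
  shows "0 < Min (q ` {0..K})" "Min (q ` {0..K}) \<le> 1" "\<And>k. k \<le> K \<Longrightarrow> Min (q ` {0..K}) \<le> q k"
proof -
  show "0 < Min (q ` {0..K})" using q_pos by (subst Min_gr_iff) auto
  show *: "\<And>k. k \<le> K \<Longrightarrow> Min (q ` {0..K}) \<le> q k" by (intro Min_le) auto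
  show "Min (q ` {0..K}) \<le> 1" using *[of 0] q_le_1[of 0] by linarith
qed

lemma contraction_factor_bounds: "0 \<le> contraction_factor" "contraction_factor < 1"
proof -
  have "Min (q ` {0..K}) * exp (- 1) \<le> 1 * 1"
    using Min_rate by (intro mult_mono) auto
  then show "0 \<le> contraction_factor" by (simp add: contraction_factor_def)
  show "contraction_factor < 1" using Min_rate by (simp add: contraction_factor_def)
qed

text \<open>Where the mean rate of \<open>x\<close> is the larger one, the arrivals at stage 0 after a success differ
  by a nonnegative amount, because \<open>s exp (- s)\<close> increases for \<open>s \<le> 1\<close>, and all contributions of
  the collision probabilities cancel up to a loss of
  \<open>exp (- s) (\<Sum>k. q k (\<bar>x k - y k\<bar> - (x k - y k)))\<close>.  As \<open>x\<close> and \<open>y\<close> have equal mass, replacing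
  \<open>q k\<close> by its minimum makes this a multiple of the \<open>l1\<close>-distance.\<close>

lemma euler_step_contraction:
  assumes x: "x \<in> prob_vectors K" and y: "y \<in> prob_vectors K"
  shows "l1_dist K (euler_step x) (euler_step y) \<le> contraction_factor * l1_dist K x y"
proof -
  define s where "s = mean_rate K q"
  define \<gamma> where "\<gamma> = collision_prob K q"
  have \<gamma>: "\<gamma> x = 1 - exp (- s x)" for x by (simp add: \<gamma>_def s_def collision_prob_def)
  \<comment> \<open>The bound is symmetric in the two states, so ordered mean rates suffice. The
    order fixes the signs of \<open>\<gamma> x - \<gamma> y\<close> and of the difference of the
    success flows.\<close>
  have main: "l1_dist K (euler_step x) (euler_step y) \<le> contraction_factor * l1_dist K x y"
    if x: "x \<in> prob_vectors K" and y: "y \<in> prob_vectors K" and le: "s y \<le> s x" for x y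
  proof -
    have \<gamma>0: "0 \<le> \<gamma> x" using mean_rate_bounds[OF x] by (simp add: \<gamma> s_def)
    have \<gamma>le: "\<gamma> y \<le> \<gamma> x" using le by (simp add: \<gamma>)
    have fle: "s y * exp (- s y) \<le> s x * exp (- s x)"
      using le mean_rate_bounds[OF x] by (intro mult_exp_neg_mono) (simp_all add: s_def)
    define d where "d k = \<bar>x k - y k\<bar>" for k
    \<comment> \<open>\<open>a k\<close> bounds the change of the collision flow out of stage
      \<open>k\<close>. The product difference is split so that \<open>\<gamma> x\<close> goes with
      \<open>x - y\<close>, and \<open>y\<close> with \<open>\<gamma> x - \<gamma> y\<close>, whose
      sign is known; the second part then sums to a multiple of \<open>s y\<close>.\<close>
    define a where "a k = \<gamma> x * (q k * d k) + (\<gamma> x - \<gamma> y) * (q k * y k)" for k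
    have flux: "\<bar>\<gamma> x * (q j * x j) - \<gamma> y * (q j * y j)\<bar> \<le> a j" if "j \<le> K" for j
    proof -
      have "\<gamma> x * (q j * x j) - \<gamma> y * (q j * y j)
          = \<gamma> x * (q j * (x j - y j)) + (\<gamma> x - \<gamma> y) * (q j * y j)"
        by (simp add: algebra_simps)
      also have "\<bar>\<dots>\<bar> \<le> \<bar>\<gamma> x * (q j * (x j - y j))\<bar> + \<bar>(\<gamma> x - \<gamma> y) * (q j * y j)\<bar>"
        by (rule abs_triangle_ineq)
      also have "\<dots> = a j"
        using \<gamma>0 \<gamma>le q_pos[OF that] y that by (simp add: a_def d_def abs_mult prob_vectors_def)
      finally show ?thesis .
    qed
    have "l1_dist K (euler_step x) (euler_step y) \<le> (\<Sum>k=0..K. (d k - q k * d k)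
        + (if k = 0 then a K else a (k - 1))
        + (if k = 0 then s x * exp (- s x) - s y * exp (- s y) else 0))"
      unfolding l1_dist_def
    proof (rule sum_mono)
      fix k assume "k \<in> {0..K}"
      then have k: "k \<le> K" by simp
      \<comment> \<open>Stage \<open>j\<close> is the one that feeds stage \<open>k\<close> after a
        collision, in cyclic order.\<close>
      define j where "j = (if k = 0 then K else k - 1)"
      have j: "j \<le> K" using k by (auto simp: j_def)
      define r where "r z = (if k = 0 then s z * exp (- s z) else 0)" for z
      have step: "euler_step z k = (1 - q k) * z k + \<gamma> z * (q j * z j) + r z" for z
        using k by (simp add: euler_step_def j_def r_def s_def \<gamma>_def)
      have "\<bar>(1 - q k) * x k - (1 - q k) * y k\<bar> = d k - q k * d k"
      proof -
        have "\<bar>1 - q k\<bar> = 1 - q k" using q_le_1[OF k] by simp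
        then have "\<bar>(1 - q k) * x k - (1 - q k) * y k\<bar> = (1 - q k) * d k"
          by (simp only: right_diff_distrib[symmetric] abs_mult d_def)
        then show ?thesis by (simp add: left_diff_distrib)
      qed
      moreover have "\<bar>r x - r y\<bar> = (if k = 0 then s x * exp (- s x) - s y * exp (- s y) else 0)"
        using fle by (simp add: r_def)
      moreover have "a j = (if k = 0 then a K else a (k - 1))" by (simp add: j_def)
      ultimately show "\<bar>euler_step x k - euler_step y k\<bar> \<le> (d k - q k * d k)
        + (if k = 0 then a K else a (k - 1))
        + (if k = 0 then s x * exp (- s x) - s y * exp (- s y) else 0)"
        using flux[OF j] unfolding step by linarith
    qed
    also have "\<dots> = (\<Sum>k=0..K. d k) - (\<Sum>k=0..K. q k * d k) + (\<Sum>k=0..K. a k)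
        + (s x * exp (- s x) - s y * exp (- s y))"
      unfolding sum.distrib sum_subtractf sum_cyclic_shift by simp
    also have "(\<Sum>k=0..K. a k) = \<gamma> x * (\<Sum>k=0..K. q k * d k) + (\<gamma> x - \<gamma> y) * s y"
      unfolding a_def sum.distrib sum_distrib_left[symmetric] by (simp add: s_def mean_rate_def)
    \<comment> \<open>By \<open>\<gamma> = 1 - exp (- s)\<close>, the term
      \<open>(\<gamma> x - \<gamma> y) * s y\<close> and the success difference add up to
      \<open>exp (- s x) * (s x - s y)\<close>.\<close>
    also have "(\<Sum>k=0..K. d k) - (\<Sum>k=0..K. q k * d k)
        + (\<gamma> x * (\<Sum>k=0..K. q k * d k) + (\<gamma> x - \<gamma> y) * s y)
        + (s x * exp (- s x) - s y * exp (- s y))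
      = (\<Sum>k=0..K. d k) - exp (- s x) * ((\<Sum>k=0..K. q k * d k) - (s x - s y))"
      by (simp add: \<gamma> algebra_simps)
    also have "(\<Sum>k=0..K. q k * d k) - (s x - s y) = (\<Sum>k=0..K. q k * (d k - (x k - y k)))"
      by (simp add: s_def mean_rate_def sum_subtractf right_diff_distrib)
    also have "(\<Sum>k=0..K. d k) - exp (- s x) * \<dots> \<le> contraction_factor * (\<Sum>k=0..K. d k)"
    proof -
      have "Min (q ` {0..K}) * (\<Sum>k=0..K. d k)
          = (\<Sum>k=0..K. Min (q ` {0..K}) * (d k - (x k - y k)))"
        using x y by (simp add: sum_distrib_left[symmetric] sum_subtractf prob_vectors_def)
      also have "\<dots> \<le> (\<Sum>k=0..K. q k * (d k - (x k - y k)))"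
        by (intro sum_mono mult_right_mono) (auto simp: d_def intro!: Min_rate(3))
      finally have *: "Min (q ` {0..K}) * (\<Sum>k=0..K. d k) \<le> (\<Sum>k=0..K. q k * (d k - (x k - y k)))" .
      have "exp (- 1) * (Min (q ` {0..K}) * (\<Sum>k=0..K. d k))
          \<le> exp (- s x) * (\<Sum>k=0..K. q k * (d k - (x k - y k)))"
        using * mean_rate_bounds[OF x] Min_rate(1)
        by (intro mult_mono) (auto simp: s_def d_def intro!: mult_nonneg_nonneg sum_nonneg q_pos[THEN less_imp_le])
      then show ?thesis by (simp add: contraction_factor_def algebra_simps)
    qed
    finally show ?thesis by (simp add: l1_dist_def d_def)
  qed
  show ?thesis
  proof (cases "s y \<le> s x")
    case True
    then show ?thesis using main x y by blast
  next
    case False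
    then show ?thesis using main[OF y x] by (simp add: l1_dist_commute)
  qed
qed

section \<open>Existence and uniqueness of the equilibrium\<close>

text \<open>Vanishing drift in stages 1 to \<open>K\<close> is the fixed point equation there; stage
  0 follows because \<open>euler_step\<close> preserves the total, and beyond \<open>K\<close> both
  sides vanish.\<close>

lemma is_equilibrium_iff:
  "is_equilibrium K q x \<longleftrightarrow> x \<in> prob_vectors K \<and> euler_step x = x"
proof (intro iffI conjI)
  assume eq: "is_equilibrium K q x"
  then show x: "x \<in> prob_vectors K" by (simp add: is_equilibrium_def)
  have pos: "euler_step x k = x k" if "k \<in> {1..K}" for k
    using eq that euler_step_pos[OF that] by (simp add: is_equilibrium_def)
  have "(\<Sum>k=Suc 0..K. euler_step x k) = (\<Sum>k=Suc 0..K. x k)"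
    by (rule sum.cong) (auto intro!: pos)
  then have "euler_step x 0 = x 0"
    using sum_euler_step[of x] by (simp add: sum.atLeast_Suc_atMost)
  moreover have "euler_step x k = x k" if "k > K" for k
    using x that by (simp add: prob_vectors_def euler_step_def)
  moreover have "k \<in> {1..K} \<or> k = 0 \<or> k > K" for k by auto
  ultimately have "euler_step x k = x k" for k using pos by blast
  then show "euler_step x = x" ..
next
  assume *: "x \<in> prob_vectors K \<and> euler_step x = x"
  have "drift K q x k = 0" if "k \<in> {1..K}" for k
    using euler_step_pos[OF that, of x] * by simp
  with * show "is_equilibrium K q x" by (simp add: is_equilibrium_def)
qed

lemma equilibrium_exists: "\<exists>x. is_equilibrium K q x"
proof -
  let ?M = "{X :: unit \<Rightarrow> nat \<Rightarrow> real. X () \<in> prob_vectors K}"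
  obtain X where X: "X \<in> ?M" and fp: "\<And>i. i \<in> {()} \<Longrightarrow> euler_step (X i) = X i"
  proof (rule contraction_fixed_point[where M = ?M and K = K and I = "{()}" and D = 2
          and A = "\<lambda>X i. euler_step (X i)"])
    show "0 \<le> contraction_factor" "contraction_factor < 1" by (rule contraction_factor_bounds)+
    show "(\<lambda>_ k. if k = 0 then 1 else 0) \<in> ?M" using prob_vectors_nonempty by simp
    show "l1_dist K (euler_step (x i)) (euler_step (y i)) \<le> contraction_factor * C"
      if "x \<in> ?M" "y \<in> ?M" and C: "\<And>i. i \<in> {()} \<Longrightarrow> l1_dist K (x i) (y i) \<le> C" for x y C and i :: unit
      using euler_step_contraction[of "x i" "y i"] that(1,2)
        mult_left_mono[OF C[of i] contraction_factor_bounds(1)] by simp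
    show "x \<in> ?M" if "\<And>n. X n \<in> ?M"
      and "\<And>k. uniform_limit {()} (\<lambda>n i. X n i k) (\<lambda>i. x i k) sequentially" for X x
    proof -
      have "(\<lambda>n. X n () k) \<longlonglongrightarrow> x () k" for k
        using tendsto_uniform_limitI[OF that(2)] by simp
      then show ?thesis using prob_vectors_closed[of "\<lambda>n. X n ()"] that(1) by simp
    qed
    show "x i k = 0" if "x \<in> ?M" "k > K" for x k and i :: unit
      using that by (simp add: prob_vectors_def)
  qed (simp_all add: euler_step_in_prob_vectors l1_dist_prob_vectors_le)
  have "is_equilibrium K q (X ())"
  proof (rule is_equilibrium_iff[THEN iffD2, OF conjI])
    show "X () \<in> prob_vectors K" using X by simp
    show "euler_step (X ()) = X ()" by (rule fp) simp
  qed
  then show ?thesis by (intro exI[of _ "X ()"])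
qed

lemma equilibrium_unique:
  assumes "is_equilibrium K q x" "is_equilibrium K q y"
  shows "y = x"
proof -
  have x: "x \<in> prob_vectors K" "euler_step x = x" and y: "y \<in> prob_vectors K" "euler_step y = y"
    using assms by (auto simp: is_equilibrium_iff)
  have "l1_dist K x y \<le> contraction_factor * l1_dist K x y"
    using euler_step_contraction[OF x(1) y(1)] x y by simp
  then have "(1 - contraction_factor) * l1_dist K x y \<le> 0" by (simp add: algebra_simps)
  then have "l1_dist K x y = 0"
    using contraction_factor_bounds l1_dist_nonneg[of K x y] by (simp add: mult_le_0_iff)
  then have "y k = x k" if "k \<le> K" for k
    using l1_dist_component[OF that, of x y] by simp
  moreover have "y k = x k" if "k > K" for k
    using x(1) y(1) that by (simp add: prob_vectors_def)
  ultimately show ?thesis by (metis ext linorder_not_le)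
qed

section \<open>The integral operator on curves\<close>

text \<open>Values at negative times are left free, so fixed point equations between curves are
  stated for \<open>t \<ge> 0\<close> only.\<close>

definition curves :: "(real \<Rightarrow> nat \<Rightarrow> real) set" where
  "curves = {X. (\<forall>t\<ge>0. X t \<in> prob_vectors K) \<and> (\<forall>k. continuous_on {0..} (\<lambda>t. X t k))}"

lemma curvesD:
  assumes "X \<in> curves"
  shows "t \<ge> 0 \<Longrightarrow> X t \<in> prob_vectors K" "continuous_on {0..} (\<lambda>t. X t k)"
  using assms by (auto simp: curves_def)

lemma continuous_on_euler_step:
  assumes "X \<in> curves"
  shows "continuous_on {0..} (\<lambda>t. euler_step (X t) k)"
  unfolding euler_step_def collision_prob_def mean_rate_def
  by (cases "k > K"; cases "k = 0") (auto intro!: continuous_intros curvesD(2)[OF assms])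

lemma continuous_on_l1_dist:
  assumes "\<And>k. continuous_on S (\<lambda>t. X t k)" "\<And>k. continuous_on S (\<lambda>t. Y t k)"
  shows "continuous_on S (\<lambda>t. l1_dist K (X t) (Y t))"
  unfolding l1_dist_def by (intro continuous_intros assms)

text \<open>Variation of constants for \<open>x' = euler_step x - x\<close>.  Unlike the plain Picard operator, this one
  takes values in the probability vectors, so no extension of the drift beyond them is needed.\<close>

definition picard :: "(nat \<Rightarrow> real) \<Rightarrow> (real \<Rightarrow> nat \<Rightarrow> real) \<Rightarrow> real \<Rightarrow> nat \<Rightarrow> real" where
  "picard x0 X t k = exp (- t) * (x0 k + integral {0..t} (\<lambda>s. exp s * euler_step (X s) k))"

lemma picard_has_derivative:
  assumes "X \<in> curves" "t \<ge> 0"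
  shows "((\<lambda>t. picard x0 X t k) has_real_derivative euler_step (X t) k - picard x0 X t k)
    (at t within {0..})"
proof -
  have "continuous_on {0..} (\<lambda>s. exp s * euler_step (X s) k)"
    by (intro continuous_intros continuous_on_euler_step assms)
  note integral_halfline_has_derivative[OF this assms(2), derivative_intros]
  show ?thesis
    unfolding picard_def
    by (auto intro!: derivative_eq_intros simp: algebra_simps exp_minus)
qed

text \<open>\<open>picard x0 X t\<close> is a weighted average of \<open>x0\<close>, with weight
  \<open>exp (- t)\<close>, and of the states \<open>euler_step (X s)\<close>, with density
  \<open>exp (s - t)\<close> on \<open>{0..t}\<close>. The total weight is 1 because
  \<open>exp\<close> has integral \<open>exp t - 1\<close>.\<close>

lemma picard_in_curves:
  assumes X: "X \<in> curves" and x0: "x0 \<in> prob_vectors K"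
  shows "picard x0 X \<in> curves"
proof -
  have int: "(\<lambda>s. exp s * euler_step (X s) k) integrable_on {0..t}" for t k
    by (intro integrable_continuous_real continuous_intros
        continuous_on_subset[OF continuous_on_euler_step[OF X]]) auto
  have step: "euler_step (X s) \<in> prob_vectors K" if "s \<ge> 0" for s
    by (intro euler_step_in_prob_vectors curvesD(1)[OF X] that)
  have "picard x0 X t \<in> prob_vectors K" if "t \<ge> 0" for t
  proof -
    have "0 \<le> picard x0 X t k" if "k \<le> K" for k
      unfolding picard_def using that x0 step
      by (intro mult_nonneg_nonneg add_nonneg_nonneg integral_nonneg int) (auto simp: prob_vectors_def)
    moreover have "picard x0 X t k = 0" if "k > K" for k
      using that x0 by (simp add: picard_def prob_vectors_def euler_step_def)
    moreover have "(\<Sum>k=0..K. picard x0 X t k) = 1"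
    proof -
      have "(\<Sum>k=0..K. integral {0..t} (\<lambda>s. exp s * euler_step (X s) k))
          = integral {0..t} (\<lambda>s. \<Sum>k=0..K. exp s * euler_step (X s) k)"
        by (rule integral_sum[symmetric]) (auto intro: int)
      also have "\<dots> = integral {0..t} exp"
        using step by (intro integral_cong) (simp add: sum_distrib_left[symmetric] prob_vectors_def)
      also have "\<dots> = exp t - 1"
        using integral_exp_interval[OF that] .
      finally show ?thesis
        using x0 unfolding picard_def sum_distrib_left[symmetric] sum.distrib
        by (simp add: prob_vectors_def exp_minus)
    qed
    ultimately show ?thesis by (simp add: prob_vectors_def)
  qed
  moreover have "continuous_on {0..} (\<lambda>t. picard x0 X t k)" for k
    by (rule DERIV_continuous_on) (use picard_has_derivative[OF X] in auto)
  ultimately show ?thesis by (simp add: curves_def)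
qed

text \<open>The contraction of \<open>euler_step\<close> is applied under the integral. The initial
  states may differ: existence takes them equal, while convergence compares a solution with the
  constant equilibrium curve.\<close>

lemma picard_dist:
  assumes X: "X \<in> curves" and Y: "Y \<in> curves" and t: "t \<ge> 0"
  shows "exp t * l1_dist K (picard x0 X t) (picard y0 Y t)
    \<le> l1_dist K x0 y0 + contraction_factor * integral {0..t} (\<lambda>s. exp s * l1_dist K (X s) (Y s))"
proof -
  have cont: "continuous_on {0..t} (\<lambda>s. euler_step (Z s) k)" if "Z \<in> curves" for Z k
    by (rule continuous_on_subset[OF continuous_on_euler_step[OF that]]) auto
  have int: "(\<lambda>s. exp s * euler_step (Z s) k) integrable_on {0..t}" if "Z \<in> curves" for Z k
    by (intro integrable_continuous_real continuous_intros cont that)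
  have int_abs: "(\<lambda>s. exp s * \<bar>euler_step (X s) k - euler_step (Y s) k\<bar>) integrable_on {0..t}" for k
    by (intro integrable_continuous_real continuous_intros cont X Y)
  have component: "exp t * \<bar>picard x0 X t k - picard y0 Y t k\<bar>
      \<le> \<bar>x0 k - y0 k\<bar> + integral {0..t} (\<lambda>s. exp s * \<bar>euler_step (X s) k - euler_step (Y s) k\<bar>)" for k
  proof -
    have "exp t * \<bar>picard x0 X t k - picard y0 Y t k\<bar> = \<bar>exp t * (picard x0 X t k - picard y0 Y t k)\<bar>"
      by (simp add: abs_mult)
    also have "exp t * (picard x0 X t k - picard y0 Y t k) = (x0 k - y0 k)
        + integral {0..t} (\<lambda>s. exp s * euler_step (X s) k - exp s * euler_step (Y s) k)"
      unfolding integral_diff[OF int[OF X] int[OF Y]]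
      by (simp add: picard_def exp_minus field_simps)
    also have "\<bar>\<dots>\<bar> \<le> \<bar>x0 k - y0 k\<bar>
        + \<bar>integral {0..t} (\<lambda>s. exp s * euler_step (X s) k - exp s * euler_step (Y s) k)\<bar>"
      by (rule abs_triangle_ineq)
    also have "\<bar>integral {0..t} (\<lambda>s. exp s * euler_step (X s) k - exp s * euler_step (Y s) k)\<bar>
        \<le> integral {0..t} (\<lambda>s. exp s * \<bar>euler_step (X s) k - euler_step (Y s) k\<bar>)"
      unfolding real_norm_def[symmetric]
    proof (rule integral_norm_bound_integral)
      show "(\<lambda>s. exp s * euler_step (X s) k - exp s * euler_step (Y s) k) integrable_on {0..t}"
        by (intro integrable_diff int X Y)
    qed (simp_all add: int_abs abs_mult flip: right_diff_distrib)
    finally show ?thesis by simp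
  qed
  have "exp t * l1_dist K (picard x0 X t) (picard y0 Y t)
      = (\<Sum>k=0..K. exp t * \<bar>picard x0 X t k - picard y0 Y t k\<bar>)"
    by (simp add: l1_dist_def sum_distrib_left)
  also have "\<dots> \<le> (\<Sum>k=0..K. \<bar>x0 k - y0 k\<bar>
      + integral {0..t} (\<lambda>s. exp s * \<bar>euler_step (X s) k - euler_step (Y s) k\<bar>))"
    by (intro sum_mono component)
  also have "\<dots> = l1_dist K x0 y0
      + integral {0..t} (\<lambda>s. \<Sum>k=0..K. exp s * \<bar>euler_step (X s) k - euler_step (Y s) k\<bar>)"
    unfolding sum.distrib by (subst integral_sum) (auto intro: int_abs simp: l1_dist_def)
  also have "integral {0..t} (\<lambda>s. \<Sum>k=0..K. exp s * \<bar>euler_step (X s) k - euler_step (Y s) k\<bar>)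
      \<le> integral {0..t} (\<lambda>s. contraction_factor * (exp s * l1_dist K (X s) (Y s)))"
  proof (rule integral_le)
    show "(\<lambda>s. \<Sum>k=0..K. exp s * \<bar>euler_step (X s) k - euler_step (Y s) k\<bar>) integrable_on {0..t}"
      by (intro integrable_sum int_abs) auto
    have "continuous_on {0..} (\<lambda>s. l1_dist K (X s) (Y s))"
      by (intro continuous_on_l1_dist curvesD X Y)
    then show "(\<lambda>s. contraction_factor * (exp s * l1_dist K (X s) (Y s))) integrable_on {0..t}"
      by (intro integrable_continuous_real continuous_intros) (auto elim: continuous_on_subset)
    show "(\<Sum>k=0..K. exp s * \<bar>euler_step (X s) k - euler_step (Y s) k\<bar>)
        \<le> contraction_factor * (exp s * l1_dist K (X s) (Y s))" if "s \<in> {0..t}" for s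
      using euler_step_contraction[OF curvesD(1)[OF X] curvesD(1)[OF Y], of s s] that
      by (simp add: sum_distrib_left[symmetric] l1_dist_def[of K "euler_step _", symmetric]
          mult.left_commute)
  qed
  finally show ?thesis by simp
qed

section \<open>Solutions as fixed points of the integral operator\<close>

text \<open>Stage 0 has no differential equation of its own; its continuity comes from the other
  stages through the normalisation.\<close>

lemma is_solution_in_curves:
  assumes "is_solution K q \<phi>"
  shows "\<phi> \<in> curves"
proof -
  have P: "\<phi> t \<in> prob_vectors K" if "t \<ge> 0" for t
    using assms that by (simp add: is_solution_def)
  have pos: "continuous_on {0..} (\<lambda>t. \<phi> t k)" if "k \<in> {1..K}" for k
    by (rule DERIV_continuous_on[where D = "\<lambda>t. drift K q (\<phi> t) k"])
      (use assms that in \<open>auto simp: is_solution_def\<close>)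
  have "continuous_on {0..} (\<lambda>t. \<phi> t k)" for k
  proof -
    consider "k \<in> {1..K}" | "k > K" | "k = 0" by fastforce
    then show ?thesis
    proof cases
      case 1
      then show ?thesis by (rule pos)
    next
      case 2
      then have "continuous_on {0..} (\<lambda>t. \<phi> t k) = continuous_on {0..} (\<lambda>t::real. 0::real)"
        using P by (intro continuous_on_cong) (auto simp: prob_vectors_def)
      then show ?thesis by simp
    next
      case 3
      have "\<phi> t k = 1 - (\<Sum>j=1..K. \<phi> t j)" if "t \<ge> 0" for t
        using P[OF that] 3 by (simp add: prob_vectors_def sum.atLeast_Suc_atMost)
      then have "continuous_on {0..} (\<lambda>t. \<phi> t k)
          = continuous_on {0..} (\<lambda>t. 1 - (\<Sum>j=1..K. \<phi> t j))"
        by (intro continuous_on_cong) auto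
      then show ?thesis by (auto intro!: continuous_intros pos)
    qed
  qed
  with P show ?thesis by (simp add: curves_def)
qed

text \<open>In stages 1 to \<open>K\<close> the equation reads
  \<open>\<phi>' = euler_step \<phi> - \<phi>\<close>, and \<open>exp t\<close> is its integrating
  factor. Stage 0 of the integral equation follows since both sides are probability vectors.\<close>

lemma is_solution_iff_picard:
  assumes "\<phi> \<in> curves"
  shows "is_solution K q \<phi> \<longleftrightarrow> (\<forall>t\<ge>0. picard (\<phi> 0) \<phi> t = \<phi> t)"
proof
  assume sol: "is_solution K q \<phi>"
  have P: "\<phi> t \<in> prob_vectors K" "picard (\<phi> 0) \<phi> t \<in> prob_vectors K" if "t \<ge> 0" for t
    using that assms curvesD(1) picard_in_curves by blast+
  have pos: "picard (\<phi> 0) \<phi> t k = \<phi> t k" if t: "t \<ge> 0" and k: "k \<in> {1..K}" for t k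
  proof -
    have der: "((\<lambda>s. exp s * \<phi> s k) has_real_derivative exp s * euler_step (\<phi> s) k) (at s within {0..})"
      if "s \<ge> 0" for s
    proof -
      have "((\<lambda>s. \<phi> s k) has_real_derivative drift K q (\<phi> s) k) (at s within {0..})"
        using sol k that by (simp add: is_solution_def)
      note [derivative_intros] = this
      show ?thesis
        by (auto intro!: derivative_eq_intros simp: euler_step_pos[OF k] algebra_simps)
    qed
    have "((\<lambda>s. exp s * euler_step (\<phi> s) k) has_integral exp t * \<phi> t k - exp 0 * \<phi> 0 k) {0..t}"
    proof (rule fundamental_theorem_of_calculus[OF t])
      fix s assume "s \<in> {0..t}"
      then show "((\<lambda>s. exp s * \<phi> s k) has_vector_derivative exp s * euler_step (\<phi> s) k)
          (at s within {0..t})"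
        unfolding has_real_derivative_iff_has_vector_derivative[symmetric]
        by (intro DERIV_subset[OF der]) auto
    qed
    then show ?thesis by (simp add: picard_def integral_unique exp_minus)
  qed
  have "picard (\<phi> 0) \<phi> t k = \<phi> t k" if t: "t \<ge> 0" for t k
  proof -
    consider "k \<in> {1..K}" | "k > K" | "k = 0" by fastforce
    then show ?thesis
    proof cases
      case 1
      then show ?thesis by (rule pos[OF t])
    next
      case 2
      then show ?thesis using P[OF t] by (simp add: prob_vectors_def)
    next
      case 3
      have "(\<Sum>k=Suc 0..K. picard (\<phi> 0) \<phi> t k) = (\<Sum>k=Suc 0..K. \<phi> t k)"
        using pos[OF t] by (intro sum.cong) auto
      then show ?thesis
        using P[OF t] 3 by (simp add: prob_vectors_def sum.atLeast_Suc_atMost)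
    qed
  qed
  then show "\<forall>t\<ge>0. picard (\<phi> 0) \<phi> t = \<phi> t" by (intro allI impI ext)
next
  assume fp: "\<forall>t\<ge>0. picard (\<phi> 0) \<phi> t = \<phi> t"
  show "is_solution K q \<phi>"
    unfolding is_solution_def
  proof (intro allI impI conjI ballI)
    fix t :: real assume t: "t \<ge> 0"
    then show "\<phi> t \<in> prob_vectors K" by (rule curvesD(1)[OF assms])
    fix k assume k: "k \<in> {1..K}"
    have "((\<lambda>s. picard (\<phi> 0) \<phi> s k) has_real_derivative drift K q (\<phi> t) k) (at t within {0..})"
      using picard_has_derivative[OF assms t, of "\<phi> 0" k] fp t by (simp add: euler_step_pos[OF k])
    then show "((\<lambda>s. \<phi> s k) has_real_derivative drift K q (\<phi> t) k) (at t within {0..})"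
      by (rule has_field_derivative_transform_within[of _ _ _ _ 1]) (use fp t in auto)
  qed
qed

section \<open>Global existence and convergence\<close>

text \<open>The kernel \<open>exp (s - t)\<close> has mass at most 1 on \<open>{0..t}\<close>, so
  \<open>picard x0\<close> inherits the factor of \<open>euler_step\<close> in the supremum distance
  over the whole half-line. One fixed point is therefore a solution for all times, without
  continuation.\<close>

lemma solution_exists:
  assumes x0: "x0 \<in> prob_vectors K"
  shows "\<exists>\<phi>. is_solution K q \<phi> \<and> \<phi> 0 = x0"
proof -
  obtain \<phi> where \<phi>: "\<phi> \<in> curves" "\<And>t. t \<in> {0..} \<Longrightarrow> picard x0 \<phi> t = \<phi> t"
  proof (rule contraction_fixed_point[where M = curves and K = K and I = "{0..}" and D = 2
          and A = "picard x0"])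
    show "0 \<le> contraction_factor" "contraction_factor < 1" by (rule contraction_factor_bounds)+
    show "(\<lambda>_. x0) \<in> curves" using x0 by (simp add: curves_def)
    show "l1_dist K (picard x0 X t) (picard x0 Y t) \<le> contraction_factor * C"
      if X: "X \<in> curves" and Y: "Y \<in> curves"
        and C: "\<And>t. t \<in> {0..} \<Longrightarrow> l1_dist K (X t) (Y t) \<le> C" and t: "t \<in> {0..}" for X Y C t
    proof -
      have C0: "0 \<le> C" using C[OF t] l1_dist_nonneg order_trans by blast
      have cont: "continuous_on {0..} (\<lambda>s. l1_dist K (X s) (Y s))"
        by (intro continuous_on_l1_dist curvesD X Y)
      have "integral {0..t} (\<lambda>s. exp s * l1_dist K (X s) (Y s)) \<le> integral {0..t} (\<lambda>s. exp s * C)"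
        using C by (intro integral_le integrable_continuous_real continuous_intros
            continuous_on_subset[OF cont]) auto
      also have "\<dots> = (exp t - 1) * C"
        using integral_exp_interval[of t] t by simp
      also have "\<dots> \<le> exp t * C" using C0 by (simp add: algebra_simps)
      finally have "contraction_factor * integral {0..t} (\<lambda>s. exp s * l1_dist K (X s) (Y s))
          \<le> contraction_factor * (exp t * C)"
        by (rule mult_left_mono) (rule contraction_factor_bounds)
      moreover have "exp t * l1_dist K (picard x0 X t) (picard x0 Y t)
          \<le> contraction_factor * integral {0..t} (\<lambda>s. exp s * l1_dist K (X s) (Y s))"
        using picard_dist[OF X Y, of t x0 x0] t by (simp add: l1_dist_def[of K x0 x0])
      ultimately have "exp t * l1_dist K (picard x0 X t) (picard x0 Y t)
          \<le> exp t * (contraction_factor * C)"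
        unfolding mult.left_commute[of "exp t"] by (rule order_trans[rotated])
      then show ?thesis by (rule mult_left_le_imp_le) simp
    qed
    show "x \<in> curves" if X: "\<And>n. X n \<in> curves"
      and lim: "\<And>k. uniform_limit {0..} (\<lambda>n t. X n t k) (\<lambda>t. x t k) sequentially" for X x
    proof -
      have "continuous_on {0..} (\<lambda>t. x t k)" for k
        by (rule uniform_limit_theorem[OF _ lim]) (simp_all add: curvesD(2)[OF X])
      moreover have "x t \<in> prob_vectors K" if "t \<ge> 0" for t
        by (rule prob_vectors_closed[of "\<lambda>n. X n t"])
          (use that in \<open>auto intro!: curvesD(1) X tendsto_uniform_limitI[OF lim]\<close>)
      ultimately show ?thesis by (simp add: curves_def)
    qed
  qed (use x0 in \<open>auto intro: picard_in_curves l1_dist_prob_vectors_le curvesD(1)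
        dest: curvesD(1) simp: prob_vectors_def\<close>)
  have "picard x0 \<phi> 0 = x0" by (rule ext) (simp add: picard_def)
  then have "\<phi> 0 = x0" using \<phi>(2)[of 0] by simp
  then show ?thesis using \<phi> is_solution_iff_picard by auto
qed

text \<open>The equilibrium is a constant solution, so \<open>picard_dist\<close> applies to the
  pair, and \<open>gronwall_exp\<close> turns its estimate into decay of the l1-distance at rate
  \<open>1 - contraction_factor\<close>.\<close>

lemma solution_converges:
  assumes sol: "is_solution K q \<phi>" and eq: "is_equilibrium K q x" and k: "k \<le> K"
  shows "((\<lambda>t. \<phi> t k) \<longlongrightarrow> x k) at_top"
proof -
  have \<phi>: "\<phi> \<in> curves" by (rule is_solution_in_curves[OF sol])
  have "is_solution K q (\<lambda>_. x)"
    using eq by (auto simp: is_solution_def is_equilibrium_def)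
  then have xc: "(\<lambda>_. x) \<in> curves" and x: "\<forall>t\<ge>0. picard x (\<lambda>_. x) t = x"
    using is_solution_in_curves is_solution_iff_picard by blast+
  have "l1_dist K (\<phi> t) x \<le> l1_dist K (\<phi> 0) x * exp (- (1 - contraction_factor) * t)"
    if "t \<ge> 0" for t
  proof (rule gronwall_exp[OF _ _ that])
    show "continuous_on {0..} (\<lambda>t. l1_dist K (\<phi> t) x)"
      using continuous_on_l1_dist[of "{0..}" \<phi> "\<lambda>_. x"] curvesD(2)[OF \<phi>] by simp
    show "exp t * l1_dist K (\<phi> t) x \<le> l1_dist K (\<phi> 0) x
        + contraction_factor * integral {0..t} (\<lambda>s. exp s * l1_dist K (\<phi> s) x)" if "t \<ge> 0" for t
      using picard_dist[OF \<phi> xc that, of "\<phi> 0" x] x that sol is_solution_iff_picard[OF \<phi>] by simp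
  qed (rule contraction_factor_bounds)
  then have "\<bar>\<phi> t k - x k\<bar> \<le> l1_dist K (\<phi> 0) x * exp (- (1 - contraction_factor) * t)"
    if "t \<ge> 0" for t
    using l1_dist_component[OF k] that order_trans by blast
  then have bound: "\<forall>\<^sub>F t in at_top. norm (\<phi> t k - x k)
      \<le> l1_dist K (\<phi> 0) x * exp (- (1 - contraction_factor) * t)"
    by (intro eventually_at_top_linorderI[of 0]) simp
  have "((\<lambda>t. l1_dist K (\<phi> 0) x * exp (- (1 - contraction_factor) * t)) \<longlongrightarrow> 0) at_top"
    using contraction_factor_bounds(2)
    by (intro tendsto_mult_right_zero filterlim_compose[OF exp_at_bot]
        filterlim_tendsto_neg_mult_at_bot[OF tendsto_const _ filterlim_ident]) auto
  then have "((\<lambda>t. \<phi> t k - x k) \<longlongrightarrow> 0) at_top"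
    by (rule Lim_null_comparison[OF bound])
  then show ?thesis by (simp add: LIM_zero_iff)
qed

end

theorem theorem1:
  fixes K :: nat and q :: "nat \<Rightarrow> real"
  assumes "K \<ge> 1"
    and "\<And>k. k \<le> K \<Longrightarrow> q k > 0"
    and "\<And>k. k \<le> K \<Longrightarrow> q k \<le> 1"
  shows "globally_stable K q"
proof -
  interpret slow_backoff K q by unfold_locales (use assms in auto)
  obtain x where "is_equilibrium K q x" using equilibrium_exists by blast
  then show ?thesis
    unfolding globally_stable_def
    by (intro exI[of _ x] conjI allI ballI impI equilibrium_unique solution_exists
        solution_converges) auto
qed

end
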